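(* There is an algorithm which, given a positive integer $N$, an integer $d\in[0,N]$ and a set $E\subseteq[0,N]$ (given by its indicator vector in $\{0,1\}^{N+1}$), computes the (indicator vector of the) set $\overline{L}_{N,d}(E)$ in time $O(N)$.
   Context: For integers $a\le b$, $[a,b]$ denotes the set of integers $t$ with $a\le t\le b$. For $d\in[0,N]$ and $E=\{t_1<\cdots<t_s\}\subseteq[0,N]$, define $L_{N,d}(E)=E$ if $|E|\le d$, and $L_{N,d}(E)=[0,t_{s-d}]\cup E\cup[t_{d+1},N]$ if $|E|\ge d+1$. With $L_{N,d}^0=\mathrm{id}$ and $L_{N,d}^{k+1}=L_{N,d}\circ L_{N,d}^k$, define $\overline{L}_{N,d}(E)=\bigcup_{k\ge0}L_{N,d}^k(E)$. Time is counted in elementary operations, ignoring bit complexity: arithmetic and comparisons on integers in $[0,N]$, and reading or writing an entry of an array, each have unit cost. *)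

theory Defs
  imports Main "HOL-Library.Indicator_Function" "HOL-Library.Landau_Symbols"
begin

section \<open>The closure operator\<close>

text \<open>The list is 0-indexed, the elements \<open>t\<^sub>1 < \<dots> < t\<^sub>s\<close> of a finite set are 1-indexed.\<close>

definition elt :: "nat set \<Rightarrow> nat \<Rightarrow> nat" where
  "elt E i = sorted_list_of_set E ! (i - 1)"

definition L :: "nat \<Rightarrow> nat \<Rightarrow> nat set \<Rightarrow> nat set" where
  "L N d E =
     (if card E \<le> d then E
      else {0..elt E (card E - d)} \<union> E \<union> {elt E (d + 1)..N})"

definition L_closure :: "nat \<Rightarrow> nat \<Rightarrow> nat set \<Rightarrow> nat set" where
  "L_closure N d E = (\<Union>k. (L N d ^^ k) E)"


section \<open>Algorithms and their running time\<close>

text \<open>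
  Algorithms are programs of a while language over integer registers and integer arrays. A program
  is a finite object that does not depend on the input, so it uses a fixed finite number of
  registers and of arrays. In a run with size parameter \<open>N\<close>, all literals, operands, results,
  array indices and array entries that occur must lie in \<open>[0,N]\<close>; evaluation is undefined
  (\<open>None\<close>) otherwise, and a program that needs an undefined value has no run. In particular a
  difference is defined only when it is nonnegative, and every array has usable indices
  \<open>0,\<dots>,N\<close> only.
\<close>

datatype aexp =
    Lit nat
  | Reg nat
  | Read nat aexp
  | Add aexp aexp
  | Sub aexp aexp
  | Mul aexp aexp
  | Quot aexp aexp
  | Rem aexp aexp

datatype bexp =
    Less aexp aexp
  | LessEq aexp aexp
  | Equal aexp aexp
  | BNot bexp
  | BAnd bexp bexp
  | BOr bexp bexp

datatype com =
    Skip
  | Assign nat aexp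
  | Write nat aexp aexp
  | Seq com com
  | Cond bexp com com
  | While bexp com

record state =
  regs :: "nat \<Rightarrow> nat"
  arrs :: "nat \<Rightarrow> nat \<Rightarrow> nat"

definition in_range :: "nat \<Rightarrow> nat \<Rightarrow> nat option" where
  "in_range N v = (if v \<le> N then Some v else None)"

fun aval :: "nat \<Rightarrow> state \<Rightarrow> aexp \<Rightarrow> nat option" where
  "aval N s (Lit n) = in_range N n"
| "aval N s (Reg x) = in_range N (regs s x)"
| "aval N s (Read A i) =
     (case aval N s i of Some k \<Rightarrow> in_range N (arrs s A k) | None \<Rightarrow> None)"
| "aval N s (Add a b) =
     (case (aval N s a, aval N s b) of
        (Some u, Some v) \<Rightarrow> in_range N (u + v) | _ \<Rightarrow> None)"
| "aval N s (Sub a b) =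
     (case (aval N s a, aval N s b) of
        (Some u, Some v) \<Rightarrow> (if v \<le> u then Some (u - v) else None) | _ \<Rightarrow> None)"
| "aval N s (Mul a b) =
     (case (aval N s a, aval N s b) of
        (Some u, Some v) \<Rightarrow> in_range N (u * v) | _ \<Rightarrow> None)"
| "aval N s (Quot a b) =
     (case (aval N s a, aval N s b) of
        (Some u, Some v) \<Rightarrow> (if v = 0 then None else Some (u div v)) | _ \<Rightarrow> None)"
| "aval N s (Rem a b) =
     (case (aval N s a, aval N s b) of
        (Some u, Some v) \<Rightarrow> (if v = 0 then None else Some (u mod v)) | _ \<Rightarrow> None)"

text \<open>Conjunction and disjunction are evaluated from left to right, with short-circuiting.\<close>

fun bval :: "nat \<Rightarrow> state \<Rightarrow> bexp \<Rightarrow> bool option" where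
  "bval N s (Less a b) =
     (case (aval N s a, aval N s b) of (Some u, Some v) \<Rightarrow> Some (u < v) | _ \<Rightarrow> None)"
| "bval N s (LessEq a b) =
     (case (aval N s a, aval N s b) of (Some u, Some v) \<Rightarrow> Some (u \<le> v) | _ \<Rightarrow> None)"
| "bval N s (Equal a b) =
     (case (aval N s a, aval N s b) of (Some u, Some v) \<Rightarrow> Some (u = v) | _ \<Rightarrow> None)"
| "bval N s (BNot b) = map_option Not (bval N s b)"
| "bval N s (BAnd b c) =
     (case bval N s b of
        None \<Rightarrow> None | Some False \<Rightarrow> Some False | Some True \<Rightarrow> bval N s c)"
| "bval N s (BOr b c) =
     (case bval N s b of
        None \<Rightarrow> None | Some True \<Rightarrow> Some True | Some False \<Rightarrow> bval N s c)"

text \<open>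
  Every literal, register access, array access, arithmetic operation, comparison and connective is
  charged one unit; operands skipped by short-circuiting are charged as well.
\<close>

fun acost :: "aexp \<Rightarrow> nat" where
  "acost (Lit n) = 1"
| "acost (Reg x) = 1"
| "acost (Read A i) = acost i + 1"
| "acost (Add a b) = acost a + acost b + 1"
| "acost (Sub a b) = acost a + acost b + 1"
| "acost (Mul a b) = acost a + acost b + 1"
| "acost (Quot a b) = acost a + acost b + 1"
| "acost (Rem a b) = acost a + acost b + 1"

fun bcost :: "bexp \<Rightarrow> nat" where
  "bcost (Less a b) = acost a + acost b + 1"
| "bcost (LessEq a b) = acost a + acost b + 1"
| "bcost (Equal a b) = acost a + acost b + 1"
| "bcost (BNot b) = bcost b + 1"
| "bcost (BAnd b c) = bcost b + bcost c + 1"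
| "bcost (BOr b c) = bcost b + bcost c + 1"

text \<open>
  \<open>exec N c s t s'\<close>: started in state \<open>s\<close>, the program \<open>c\<close> terminates in state \<open>s'\<close> after
  \<open>t\<close> elementary operations.
\<close>

inductive exec :: "nat \<Rightarrow> com \<Rightarrow> state \<Rightarrow> nat \<Rightarrow> state \<Rightarrow> bool" for N :: nat where
  Skip: "exec N Skip s 1 s"
| Assign: "aval N s a = Some v \<Longrightarrow>
     exec N (Assign x a) s (acost a + 1) (s\<lparr>regs := (regs s)(x := v)\<rparr>)"
| Write: "aval N s i = Some k \<Longrightarrow> aval N s a = Some v \<Longrightarrow>
     exec N (Write A i a) s (acost i + acost a + 1)
       (s\<lparr>arrs := (arrs s)(A := (arrs s A)(k := v))\<rparr>)"
| Seq: "exec N c s t s' \<Longrightarrow> exec N c' s' t' s'' \<Longrightarrow>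
     exec N (Seq c c') s (t + t') s''"
| CondTrue: "bval N s b = Some True \<Longrightarrow> exec N c s t s' \<Longrightarrow>
     exec N (Cond b c c') s (bcost b + t + 1) s'"
| CondFalse: "bval N s b = Some False \<Longrightarrow> exec N c' s t s' \<Longrightarrow>
     exec N (Cond b c c') s (bcost b + t + 1) s'"
| WhileFalse: "bval N s b = Some False \<Longrightarrow>
     exec N (While b c) s (bcost b + 1) s"
| WhileTrue: "bval N s b = Some True \<Longrightarrow> exec N c s t s' \<Longrightarrow>
     exec N (While b c) s' t' s'' \<Longrightarrow>
     exec N (While b c) s (bcost b + t + t' + 1) s''"

text \<open>
  A run is unique if it exists, so the existence of a run of length \<open>t\<close> with a given result
  says that the program halts after \<open>t\<close> operations with that result.
\<close>

lemma exec_deterministic: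
  assumes "exec N c s t s'" and "exec N c s u s''"
  shows "u = t \<and> s'' = s'"
  using assms
proof (induction arbitrary: u s'' rule: exec.induct)
  case (Skip s)
  then show ?case by cases simp
next
  case (Assign s a v x)
  from Assign(2) show ?case by cases (simp add: Assign(1))
next
  case (Write s i k a v A)
  from Write(3) show ?case by cases (simp add: Write(1,2))
next
  case (Seq c s t s' c' t' s2)
  from Seq.prems obtain t1 s1 t2
    where "exec N c s t1 s1" "exec N c' s1 t2 s''" "u = t1 + t2" by cases
  with Seq.IH show ?case by blast
next
  case (CondTrue s b c t s' c')
  from CondTrue.prems obtain t1 where "exec N c s t1 s''" "u = bcost b + t1 + 1"
    by cases (simp_all add: CondTrue.hyps(1))
  with CondTrue.IH show ?case by blast
next
  case (CondFalse s b c' t s' c)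
  from CondFalse.prems obtain t1 where "exec N c' s t1 s''" "u = bcost b + t1 + 1"
    by cases (simp_all add: CondFalse.hyps(1))
  with CondFalse.IH show ?case by blast
next
  case (WhileFalse s b c)
  from WhileFalse.prems show ?case by cases (simp_all add: WhileFalse.hyps)
next
  case (WhileTrue s b c t s' t' s2)
  from WhileTrue.prems obtain t1 s1 t2 where
      "exec N c s t1 s1" "exec N (While b c) s1 t2 s''" "u = bcost b + t1 + t2 + 1"
    by cases (simp_all add: WhileTrue.hyps(1))
  with WhileTrue.IH show ?case by blast
qed

text \<open>
  The input \<open>N\<close>, \<open>d\<close> is given in registers 0 and 1 and the indicator vector of \<open>E\<close> in array 0;
  nothing is assumed about the contents of the other registers and arrays.
\<close>

definition is_input :: "nat \<Rightarrow> nat \<Rightarrow> nat set \<Rightarrow> state \<Rightarrow> bool" where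
  "is_input N d E s \<longleftrightarrow>
     regs s 0 = N \<and> regs s 1 = d \<and> (\<forall>i\<in>{0..N}. arrs s 0 i = indicator E i)"

text \<open>The result is returned in array 0.\<close>

definition is_output :: "nat \<Rightarrow> nat set \<Rightarrow> state \<Rightarrow> bool" where
  "is_output N F s \<longleftrightarrow> (\<forall>i\<in>{0..N}. arrs s 0 i = indicator F i)"

end

(*
  L adds to E exactly the points t for which more than d members lie in [t,N] or more than d lie
  in [0,t], so the closure may be built one point at a time in any order. Keep pointers a <= b with
  [0,a) and (b,N] already filled. If [a,N] has more than d members then a is in the closure and may
  be filled and passed, and symmetrically for b and [0,b]. When neither test succeeds, no point of
  [a,b] can be added, so the set is closed. Both counts follow from the number of missing points,
  which each step updates in constant time.
*)
theory Submission
  imports Defs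
begin

section \<open>The closure operator via counting\<close>

lemma elt_le_iff:
  assumes "finite E" "1 \<le> k" "k \<le> card E"
  shows "elt E k \<le> t \<longleftrightarrow> k \<le> card (E \<inter> {0..t})"
proof -
  let ?xs = "sorted_list_of_set E"
  have len: "length ?xs = card E" by simp
  \<comment> \<open>The list is increasing, so the indices with entry at most \<open>t\<close> form
    an initial segment. It contains index \<open>k - 1\<close>, the 0-based place of
    \<open>elt E k\<close>, exactly when its length is at least \<open>k\<close>.\<close>
  have "elt E k \<le> t \<longleftrightarrow> k \<le> card {i. i < card E \<and> ?xs ! i \<le> t}"
  proof
    assume le: "elt E k \<le> t"
    have "{..<k} \<subseteq> {i. i < card E \<and> ?xs ! i \<le> t}"
    proof
      fix i assume "i \<in> {..<k}"
      then have "?xs ! i \<le> ?xs ! (k - 1)" using assms len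
        by (intro sorted_nth_mono) auto
      then show "i \<in> {i. i < card E \<and> ?xs ! i \<le> t}"
        using le assms \<open>i \<in> {..<k}\<close> by (auto simp: elt_def)
    qed
    then have "card {..<k} \<le> card {i. i < card E \<and> ?xs ! i \<le> t}"
      by (intro card_mono) auto
    then show "k \<le> card {i. i < card E \<and> ?xs ! i \<le> t}" by simp
  next
    assume k: "k \<le> card {i. i < card E \<and> ?xs ! i \<le> t}"
    show "elt E k \<le> t"
    proof (rule ccontr)
      assume gt: "\<not> elt E k \<le> t"
      have "{i. i < card E \<and> ?xs ! i \<le> t} \<subseteq> {..<k - 1}"
      proof
        fix i assume i: "i \<in> {i. i < card E \<and> ?xs ! i \<le> t}"
        have "\<not> k - 1 \<le> i"
        proof
          assume "k - 1 \<le> i"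
          then have "?xs ! (k - 1) \<le> ?xs ! i" using i len
            by (intro sorted_nth_mono) auto
          then show False using gt i by (auto simp: elt_def)
        qed
        then show "i \<in> {..<k - 1}" by simp
      qed
      then have "card {i. i < card E \<and> ?xs ! i \<le> t} \<le> card {..<k - 1}"
        by (intro card_mono) auto
      then show False using k assms by simp
    qed
  qed
  also have "card {i. i < card E \<and> ?xs ! i \<le> t} = card (E \<inter> {0..t})"
  proof -
    have "bij_betw ((!) ?xs) {i. i < card E \<and> ?xs ! i \<le> t} (E \<inter> {0..t})"
    proof (rule bij_betw_imageI)
      show "inj_on ((!) ?xs) {i. i < card E \<and> ?xs ! i \<le> t}"
        by (auto simp: inj_on_def nth_eq_iff_index_eq)
      have "E \<inter> {0..t} = {x \<in> set ?xs. x \<le> t}" using assms(1) by auto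
      then show "(!) ?xs ` {i. i < card E \<and> ?xs ! i \<le> t} = E \<inter> {0..t}"
        by (auto simp: set_conv_nth)
    qed
    then show ?thesis by (rule bij_betw_same_card)
  qed
  finally show ?thesis .
qed

lemma elt_mem:
  assumes "finite E" "1 \<le> k" "k \<le> card E"
  shows "elt E k \<in> E"
proof -
  have "elt E k \<in> set (sorted_list_of_set E)"
    unfolding elt_def using assms by (intro nth_mem) auto
  then show ?thesis using assms(1) by simp
qed

lemma card_split_at:
  fixes t :: nat
  assumes "E \<subseteq> {0..N}"
  shows "card E = card (E \<inter> {0..<t}) + card (E \<inter> {t..N})"
proof -
  have "finite E" using assms finite_subset by blast
  then have "card ((E \<inter> {0..<t}) \<union> (E \<inter> {t..N})) = card (E \<inter> {0..<t}) + card (E \<inter> {t..N})"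
    by (intro card_Un_disjoint) auto
  moreover have "(E \<inter> {0..<t}) \<union> (E \<inter> {t..N}) = E" using assms by auto
  ultimately show ?thesis by simp
qed

text \<open>Pass to complements: \<open>t\<close> exceeds the element of rank
  \<open>card E - d\<close> exactly when at least \<open>card E - d\<close> members lie below
  \<open>t\<close>, which leaves at most \<open>d\<close> in \<open>{t..N}\<close>. The value
  \<open>t = 0\<close> is separate because the argument uses the predecessor of
  \<open>t\<close>.\<close>

lemma le_elt_iff:
  assumes E: "E \<subseteq> {0..N}" and d: "d < card E"
  shows "t \<le> elt E (card E - d) \<longleftrightarrow> d < card (E \<inter> {t..N})"
proof (cases t)
  case 0
  then have "E \<inter> {t..N} = E" using E by auto
  then show ?thesis using 0 d by simp
next
  case (Suc u)
  have fin: "finite E" using E finite_subset by blast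
  have "t \<le> elt E (card E - d) \<longleftrightarrow> \<not> elt E (card E - d) \<le> u" using Suc by auto
  also have "\<dots> \<longleftrightarrow> card (E \<inter> {0..u}) < card E - d"
    using elt_le_iff[OF fin, of "card E - d" u] d by auto
  also have "{0..u} = {0..<t}" using Suc by auto
  also have "card (E \<inter> {0..<t}) < card E - d \<longleftrightarrow> d < card (E \<inter> {t..N})"
    using card_split_at[OF E, of t] by linarith
  finally show ?thesis .
qed

text \<open>Replaces ranks, which shift as the set grows, by counts, which can only increase with
  it. The case distinction of \<open>L_def\<close> disappears, since no count exceeds
  \<open>d\<close> when \<open>card E\<close> does not.\<close>

lemma L_alt:
  assumes E: "E \<subseteq> {0..N}"
  shows "L N d E =
    E \<union> {t \<in> {0..N}. d < card (E \<inter> {t..N}) \<or> d < card (E \<inter> {0..t})}"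
proof (cases "card E \<le> d")
  case True
  have fin: "finite E" using E finite_subset by blast
  have "\<not> d < card (E \<inter> X)" for X
    using card_mono[OF fin, of "E \<inter> X"] True by simp
  then show ?thesis using True by (simp add: L_def)
next
  case False
  have fin: "finite E" using E finite_subset by blast
  have d: "d < card E" using False by simp
  have "elt E (card E - d) \<in> E" using elt_mem[OF fin] d by simp
  then have le: "elt E (card E - d) \<le> N" using E by auto
  have left: "{0..elt E (card E - d)} = {t \<in> {0..N}. d < card (E \<inter> {t..N})}"
    unfolding le_elt_iff[OF E d, symmetric] using le by auto
  have iff: "elt E (d + 1) \<le> t \<longleftrightarrow> d < card (E \<inter> {0..t})" for t
    using elt_le_iff[OF fin, of "d + 1" t] d by (simp add: Suc_le_eq)
  have right: "{elt E (d + 1)..N} = {t \<in> {0..N}. d < card (E \<inter> {0..t})}"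
    unfolding iff[symmetric] by auto
  have "L N d E = {0..elt E (card E - d)} \<union> E \<union> {elt E (d + 1)..N}"
    using False by (simp add: L_def)
  then show ?thesis unfolding left right by blast
qed

section \<open>Monotonicity of \<open>L\<close> and minimality of the closure\<close>

lemma L_subset: "E \<subseteq> {0..N} \<Longrightarrow> L N d E \<subseteq> {0..N}"
  by (auto simp: L_alt)

lemma L_mono:
  assumes "E \<subseteq> F" "F \<subseteq> {0..N}"
  shows "L N d E \<subseteq> L N d F"
proof -
  have fin: "finite F" using assms finite_subset by blast
  have "card (E \<inter> X) \<le> card (F \<inter> X)" for X
    using assms fin by (intro card_mono) auto
  then have le: "d < card (E \<inter> X) \<Longrightarrow> d < card (F \<inter> X)" for X
    by (meson less_le_trans)
  have E: "E \<subseteq> {0..N}" using assms by (rule order_trans)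
  show ?thesis unfolding L_alt[OF E] L_alt[OF assms(2)] using assms(1) le by auto
qed

lemma funpow_L_subset: "E \<subseteq> {0..N} \<Longrightarrow> (L N d ^^ k) E \<subseteq> {0..N}"
  by (induction k) (simp_all add: L_subset)

lemma L_closure_subset: "E \<subseteq> {0..N} \<Longrightarrow> L_closure N d E \<subseteq> {0..N}"
  unfolding L_closure_def by (intro UN_least funpow_L_subset)

lemma subset_L_closure: "E \<subseteq> L_closure N d E"
  unfolding L_closure_def by (rule order_trans[OF _ UN_upper[of 0]]) auto

lemma L_closure_least:
  assumes "E \<subseteq> F" "F \<subseteq> {0..N}" "L N d F \<subseteq> F"
  shows "L_closure N d E \<subseteq> F"
proof -
  have "(L N d ^^ k) E \<subseteq> F" for k
  proof (induction k)
    case (Suc k)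
    then have "L N d ((L N d ^^ k) E) \<subseteq> L N d F" using L_mono assms(2) by blast
    then show ?case using assms(3) by simp
  qed (use assms in simp)
  then show ?thesis by (auto simp: L_closure_def)
qed

text \<open>The iterates increase and \<open>F\<close> is finite, so a single iterate contains
  \<open>F\<close>, and the next one contains \<open>L N d F\<close>. Since \<open>F\<close> need
  not itself be an iterate, this justifies adding points one at a time.\<close>

lemma L_subset_L_closure:
  assumes E: "E \<subseteq> {0..N}" and F: "F \<subseteq> L_closure N d E"
  shows "L N d F \<subseteq> L_closure N d E"
proof -
  have "(L N d ^^ k) E \<subseteq> (L N d ^^ Suc k) E" for k
    unfolding funpow.simps comp_apply L_alt[OF funpow_L_subset[OF E]] by (rule Un_upper1)
  then have inc: "mono (\<lambda>k. (L N d ^^ k) E)" by (rule incseq_SucI)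
  have "F \<subseteq> {0..N}" using F L_closure_subset[OF E] by (rule order_trans)
  then have "finite F" by (rule finite_subset) simp
  then have "\<exists>k. F \<subseteq> (L N d ^^ k) E" using F
  proof (induction F)
    case (insert x F)
    then obtain k where "F \<subseteq> (L N d ^^ k) E" by blast
    moreover have "x \<in> (\<Union>l. (L N d ^^ l) E)"
      using insert.prems unfolding L_closure_def by blast
    then obtain l where "x \<in> (L N d ^^ l) E" by (rule UN_E)
    moreover have "(L N d ^^ k) E \<subseteq> (L N d ^^ max k l) E"
      by (rule monoD[OF inc]) (rule max.cobounded1)
    moreover have "(L N d ^^ l) E \<subseteq> (L N d ^^ max k l) E"
      by (rule monoD[OF inc]) (rule max.cobounded2)
    ultimately show ?case by blast
  qed simp
  then obtain k where k: "F \<subseteq> (L N d ^^ k) E" by blast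
  have "L N d F \<subseteq> (L N d ^^ Suc k) E"
    using L_mono[OF k funpow_L_subset[OF E]] by simp
  also have "\<dots> \<subseteq> L_closure N d E" unfolding L_closure_def by (rule UN_upper) simp
  finally show ?thesis .
qed


section \<open>Weakest-precondition rules that carry a time budget\<close>

section \<open>Runs with a time bound\<close>

text \<open>An upper bound in place of the exact time allows branches of different cost to share one
  budget.\<close>

definition runs :: "nat \<Rightarrow> com \<Rightarrow> state \<Rightarrow> nat \<Rightarrow> (state \<Rightarrow> bool) \<Rightarrow> bool" where
  "runs N c s T Q \<longleftrightarrow> (\<exists>t s'. exec N c s t s' \<and> t \<le> T \<and> Q s')"

lemma runsI: "exec N c s t s' \<Longrightarrow> t \<le> T \<Longrightarrow> Q s' \<Longrightarrow> runs N c s T Q"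
  unfolding runs_def by blast

lemma runsE:
  assumes "runs N c s T Q"
  obtains t s' where "exec N c s t s'" "t \<le> T" "Q s'"
  using assms unfolding runs_def by blast

lemma runs_mono:
  "runs N c s T Q \<Longrightarrow> T \<le> T' \<Longrightarrow> (\<And>s'. Q s' \<Longrightarrow> Q' s') \<Longrightarrow> runs N c s T' Q'"
  by (elim runsE) (rule runsI, assumption, simp_all)

lemma runs_Skip: "Q s \<Longrightarrow> 1 \<le> T \<Longrightarrow> runs N Skip s T Q"
  by (rule runsI[OF exec.Skip])

lemma runs_Assign:
  "aval N s a = Some v \<Longrightarrow> Q (s\<lparr>regs := (regs s)(x := v)\<rparr>) \<Longrightarrow> acost a + 1 \<le> T \<Longrightarrow>
   runs N (Assign x a) s T Q"
  by (rule runsI[OF exec.Assign])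

lemma runs_Write:
  "aval N s i = Some k \<Longrightarrow> aval N s a = Some v \<Longrightarrow>
   Q (s\<lparr>arrs := (arrs s)(A := (arrs s A)(k := v))\<rparr>) \<Longrightarrow> acost i + acost a + 1 \<le> T \<Longrightarrow>
   runs N (Write A i a) s T Q"
  by (rule runsI[OF exec.Write])

text \<open>The run of the second command is the postcondition of the first, so repeated use of the
  rules amounts to symbolic execution.\<close>

lemma runs_Seq:
  "runs N c s T (\<lambda>s'. runs N c' s' T' Q) \<Longrightarrow> runs N (Seq c c') s (T + T') Q"
  by (elim runsE) (rule runsI[OF exec.Seq], assumption+, simp_all)

lemma runs_Cond:
  assumes "bval N s b = Some v" "v \<Longrightarrow> runs N c s T Q" "\<not> v \<Longrightarrow> runs N c' s T Q"
  shows "runs N (Cond b c c') s (bcost b + T + 1) Q"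
proof (cases v)
  case True
  then obtain t s' where t: "exec N c s t s'" "t \<le> T" "Q s'" using assms(2) by (auto elim: runsE)
  have "bval N s b = Some True" using assms(1) True by simp
  from exec.CondTrue[OF this t(1)] show ?thesis using t by (intro runsI) auto
next
  case False
  then obtain t s' where t: "exec N c' s t s'" "t \<le> T" "Q s'" using assms(3) by (auto elim: runsE)
  have "bval N s b = Some False" using assms(1) False by simp
  from exec.CondFalse[OF this t(1)] show ?thesis using t by (intro runsI) auto
qed

text \<open>Total correctness with invariant \<open>I\<close> and variant \<open>m\<close>: there
  are at most \<open>m s\<close> iterations, each paying for the test, the body and one extra unit.
  The successor pays for the final failing test.\<close>

lemma runs_While:
  assumes "I s"
    and defd: "\<And>s. I s \<Longrightarrow> bval N s b \<noteq> None"
    and step: "\<And>s. I s \<Longrightarrow> bval N s b = Some True \<Longrightarrow>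
      runs N c s K (\<lambda>s'. I s' \<and> m s' < (m s :: nat))"
    and exit: "\<And>s. I s \<Longrightarrow> bval N s b = Some False \<Longrightarrow> Q s"
  shows "runs N (While b c) s ((bcost b + K + 1) * Suc (m s)) Q"
  using \<open>I s\<close>
proof (induction "m s" arbitrary: s rule: less_induct)
  case less
  show ?case
  proof (cases "bval N s b = Some True")
    case True
    then obtain t s1 where 1: "exec N c s t s1" "t \<le> K" "I s1" "m s1 < m s"
      using step[OF less.prems] by (auto elim: runsE)
    then obtain t' s2 where 2: "exec N (While b c) s1 t' s2"
      "t' \<le> (bcost b + K + 1) * Suc (m s1)" "Q s2"
      using less.hyps[OF 1(4,3)] by (auto elim: runsE)
    have "(bcost b + K + 1) * Suc (m s1) \<le> (bcost b + K + 1) * m s"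
      using 1(4) by (intro mult_left_mono) auto
    then have "bcost b + t + t' + 1 \<le> (bcost b + K + 1) * Suc (m s)"
      using 1(2) 2(2) by simp
    then show ?thesis using runsI[OF exec.WhileTrue[OF True 1(1) 2(1)]] 2(3) by blast
  next
    case False
    then have f: "bval N s b = Some False" using defd[OF less.prems] by auto
    have "bcost b + 1 \<le> (bcost b + K + 1) * Suc (m s)" by simp
    then show ?thesis using runsI[OF exec.WhileFalse[OF f]] exit[OF less.prems f] by blast
  qed
qed


section \<open>The program\<close>

text \<open>
  Register 4 is \<open>i\<close> in the counting loop and the left pointer \<open>a\<close> afterwards, register 5 is the
  right pointer \<open>b\<close>. The number of missing points can be \<open>N + 1\<close>, which is out of range; it is
  therefore kept as the sum of register 2, a flag that is 1 if and only if some point is missing,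
  and register 3. All \<open>z\<close> missing points lie in \<open>[a,b]\<close>, so \<open>[a,N]\<close> has
  \<open>N - a - (z - 1)\<close> members and \<open>[0,b]\<close> has \<open>b - (z - 1)\<close>; these are the quantities compared
  with \<open>d\<close> in the tests. One iteration either fills the point at a pointer or moves the pointer.
\<close>

definition count_loop :: com where
  "count_loop =
     While (Less (Lit 0) (Reg 4))
       (Seq (Assign 4 (Sub (Reg 4) (Lit 1)))
         (Cond (Equal (Read 0 (Reg 4)) (Lit 0))
           (Seq (Assign 3 (Add (Reg 3) (Reg 2))) (Assign 2 (Lit 1)))
           Skip))"

definition count_missing :: com where
  "count_missing =
     Seq (Assign 2 (Sub (Lit 1) (Read 0 (Reg 0))))
       (Seq (Assign 3 (Lit 0)) (Seq (Assign 4 (Reg 0)) count_loop))"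

definition fill :: "nat \<Rightarrow> com" where
  "fill x =
     Seq (Write 0 (Reg x) (Lit 1))
       (Cond (Equal (Reg 3) (Lit 0)) (Assign 2 (Lit 0)) (Assign 3 (Sub (Reg 3) (Lit 1))))"

definition left_test :: bexp where
  "left_test = Less (Reg 1) (Sub (Sub (Reg 0) (Reg 4)) (Reg 3))"

definition right_test :: bexp where
  "right_test = Less (Reg 1) (Sub (Reg 5) (Reg 3))"

definition loop_test :: bexp where
  "loop_test = BAnd (Equal (Reg 2) (Lit 1)) (BOr left_test right_test)"

definition loop_body :: com where
  "loop_body =
     Cond left_test
       (Cond (Equal (Read 0 (Reg 4)) (Lit 1)) (Assign 4 (Add (Reg 4) (Lit 1))) (fill 4))
       (Cond (Equal (Read 0 (Reg 5)) (Lit 1)) (Assign 5 (Sub (Reg 5) (Lit 1))) (fill 5))"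

definition closure_program :: com where
  "closure_program =
     Seq count_missing
       (Seq (Assign 4 (Lit 0)) (Seq (Assign 5 (Reg 0)) (While loop_test loop_body)))"

text \<open>The pair of registers is determined by \<open>n\<close>: it is (0, 0) for
  \<open>n = 0\<close> and (1, \<open>n - 1\<close>) otherwise.\<close>

definition missing_stored :: "nat \<Rightarrow> state \<Rightarrow> bool" where
  "missing_stored n s \<longleftrightarrow>
     regs s 2 + regs s 3 = n \<and> regs s 2 \<le> 1 \<and> (regs s 2 = 0 \<longrightarrow> regs s 3 = 0)"

section \<open>Counting the missing points by a downward scan\<close>

lemma runs_count_loop:
  assumes "N > 0" "is_input N d E s" "regs s 4 = N" "missing_stored (card ({N..N} - E)) s"
  shows "runs N count_loop s (20 * Suc N)
    (\<lambda>s'. is_input N d E s' \<and> missing_stored (card ({0..N} - E)) s')"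
proof -
  \<comment> \<open>Register 4 is the least point scanned so far, and it also serves as the variant.
    The first missing point only sets the flag; each later one adds the old flag value 1 to register
    3.\<close>
  define I where "I s \<longleftrightarrow> is_input N d E s \<and> regs s 4 \<le> N \<and>
    missing_stored (card ({regs s 4..N} - E)) s" for s
  have "runs N count_loop s ((bcost (Less (Lit 0) (Reg 4)) + 16 + 1) * Suc (regs s 4))
    (\<lambda>s'. is_input N d E s' \<and> missing_stored (card ({0..N} - E)) s')"
    unfolding count_loop_def
  proof (rule runs_While[where I = I and m = "\<lambda>s. regs s 4"])
    show "I s" using assms by (simp add: I_def)
  next
    fix s assume "I s"
    then show "bval N s (Less (Lit 0) (Reg 4)) \<noteq> None" by (simp add: I_def in_range_def)
  next
    fix s assume "I s" "bval N s (Less (Lit 0) (Reg 4)) = Some False"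
    then show "is_input N d E s \<and> missing_stored (card ({0..N} - E)) s"
      by (simp add: I_def in_range_def)
  next
    fix s assume I: "I s" and b: "bval N s (Less (Lit 0) (Reg 4)) = Some True"
    then obtain i where i: "regs s 4 = Suc i" "Suc i \<le> N"
      by (cases "regs s 4") (auto simp: I_def in_range_def)
    have inp: "is_input N d E s" and ms: "missing_stored (card ({Suc i..N} - E)) s"
      using I i by (auto simp: I_def)
    have arr: "arrs s 0 i = (if i \<in> E then 1 else 0)"
      using inp i by (auto simp: is_input_def indicator_def)
    have ins: "{i..N} = insert i {Suc i..N}" using i by auto
    have card: "card ({i..N} - E) = (if i \<in> E then 0 else 1) + card ({Suc i..N} - E)"
      unfolding ins by (auto simp: insert_Diff_if)
    \<comment> \<open>Point \<open>i\<close> is not yet counted, so the stored total is at most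
      \<open>N - i\<close>; hence the sum of registers 3 and 2 stays in range.\<close>
    have "card ({Suc i..N} - E) \<le> card {Suc i..N}" by (intro card_mono) auto
    then have le: "regs s 3 + regs s 2 \<le> N" "regs s 3 \<le> N" "regs s 2 \<le> N" using ms
      by (auto simp: missing_stored_def)
    have "runs N (Seq (Assign 4 (Sub (Reg 4) (Lit 1)))
         (Cond (Equal (Read 0 (Reg 4)) (Lit 0))
           (Seq (Assign 3 (Add (Reg 3) (Reg 2))) (Assign 2 (Lit 1)))
           Skip)) s (4 + (bcost (Equal (Read 0 (Reg 4)) (Lit 0)) + (4 + 2) + 1))
       (\<lambda>s'. I s' \<and> regs s' 4 < regs s 4)"
      apply (rule runs_Seq)
      apply (rule runs_Assign[where v = i])
        apply (use i assms(1) in \<open>simp add: in_range_def\<close>)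
       apply (rule runs_Cond[where v = "i \<notin> E"])
         apply (use i arr assms(1) in \<open>simp add: in_range_def\<close>)
        apply (rule runs_Seq)
        apply (rule runs_Assign[where v = "regs s 3 + regs s 2"])
          apply (use le in \<open>simp add: in_range_def\<close>)
         apply (rule runs_Assign[where v = 1])
           apply (use assms(1) in \<open>simp add: in_range_def\<close>)
          apply (use inp ms card i in \<open>auto simp: I_def is_input_def missing_stored_def\<close>)[1]
         apply simp
        apply simp
       apply (rule runs_Skip)
        apply (use inp ms card i in \<open>auto simp: I_def is_input_def missing_stored_def\<close>)[1]
       apply simp
      apply simp
      done
    then show "runs N (Seq (Assign 4 (Sub (Reg 4) (Lit 1)))
         (Cond (Equal (Read 0 (Reg 4)) (Lit 0))
           (Seq (Assign 3 (Add (Reg 3) (Reg 2))) (Assign 2 (Lit 1)))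
           Skip)) s 16 (\<lambda>s'. I s' \<and> regs s' 4 < regs s 4)"
      by (rule runs_mono) auto
  qed
  then show ?thesis using assms(3) by simp
qed

text \<open>Point \<open>N\<close> is handled before the loop, by setting the flag to one minus its
  indicator. The scan can then start at \<open>N\<close>, avoiding the value \<open>N + 1\<close>,
  which is out of range.\<close>

lemma runs_count_missing:
  assumes "N > 0" "is_input N d E s"
  shows "runs N count_missing s (9 + 20 * Suc N)
    (\<lambda>s'. is_input N d E s' \<and> missing_stored (card ({0..N} - E)) s')"
proof -
  have arr: "regs s 0 = N" "arrs s 0 N = (if N \<in> E then 1 else 0)"
    using assms by (auto simp: is_input_def indicator_def)
  have "runs N count_missing s (5 + (2 + (2 + 20 * Suc N)))
    (\<lambda>s'. is_input N d E s' \<and> missing_stored (card ({0..N} - E)) s')"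
    unfolding count_missing_def
    apply (rule runs_Seq)
    apply (rule runs_Assign[where v = "1 - arrs s 0 N"])
      apply (use arr assms(1) in \<open>simp add: in_range_def\<close>)
     apply (rule runs_Seq)
     apply (rule runs_Assign[where v = 0])
       apply (simp add: in_range_def)
      apply (rule runs_Seq)
      apply (rule runs_Assign[where v = N])
        apply (use arr in \<open>simp add: in_range_def\<close>)
       apply (rule runs_count_loop)
          apply (use assms arr in \<open>simp_all add: is_input_def missing_stored_def insert_Diff_if\<close>)
    done
  then show ?thesis by (rule runs_mono) auto
qed

section \<open>The main loop invariant: array 0 holds a set \<open>F\<close> between
  \<open>E\<close> and its closure, with all gaps between the pointers\<close>

definition closure_inv :: "nat \<Rightarrow> nat \<Rightarrow> nat set \<Rightarrow> nat set \<Rightarrow> state \<Rightarrow> bool" where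
  "closure_inv N d E F s \<longleftrightarrow>
     E \<subseteq> F \<and> F \<subseteq> L_closure N d E \<and> is_input N d F s \<and>
     missing_stored (card ({0..N} - F)) s \<and> regs s 4 \<le> regs s 5 \<and> regs s 5 \<le> N \<and>
     {0..<regs s 4} \<subseteq> F \<and> {regs s 5<..N} \<subseteq> F"

text \<open>Pointer distance plus the number of missing points: moving a pointer lowers the first
  term by one, filling a point lowers the second by one.\<close>

definition potential :: "state \<Rightarrow> nat" where
  "potential s = regs s 5 - regs s 4 + (regs s 2 + regs s 3)"

lemma closure_inv_subset:
  assumes "closure_inv N d E F s" "E \<subseteq> {0..N}"
  shows "F \<subseteq> {0..N}"
proof -
  have "F \<subseteq> L_closure N d E" using assms(1) by (simp add: closure_inv_def)
  then show ?thesis using L_closure_subset[OF assms(2)] by (rule order_trans)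
qed

lemma closure_inv_missing:
  assumes "closure_inv N d E F s" "i \<le> N" "i \<notin> F"
  shows "regs s 4 \<le> i" and "i \<le> regs s 5"
proof -
  have "i \<notin> {0..<regs s 4}" "i \<notin> {regs s 5<..N}"
    using assms unfolding closure_inv_def by blast+
  then show "regs s 4 \<le> i" "i \<le> regs s 5" using assms(2) by auto
qed

lemma card_inter_missing:
  fixes F :: "nat set"
  assumes "finite X" "X \<subseteq> {0..N}" "{0..N} - F \<subseteq> X"
  shows "card (F \<inter> X) + card ({0..N} - F) = card X"
proof -
  have "{0..N} - F = X - F" using assms by auto
  moreover have "card ((F \<inter> X) \<union> (X - F)) = card (F \<inter> X) + card (X - F)"
    using assms by (intro card_Un_disjoint) auto
  moreover have "(F \<inter> X) \<union> (X - F) = X" by auto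
  ultimately show ?thesis by simp
qed

text \<open>With the flag set there are \<open>regs s 3 + 1\<close> missing points. All lie between
  the pointers, so subtracting them from the interval lengths gives the two counts. The third
  inequality, from the same containment, keeps the differences in the tests nonnegative and hence
  defined.\<close>

lemma closure_invD:
  assumes inv: "closure_inv N d E F s" and fl: "regs s 2 = 1"
  shows "d < regs s 0 - regs s 4 - regs s 3 \<longleftrightarrow> d < card (F \<inter> {regs s 4..N})"
    and "d < regs s 5 - regs s 3 \<longleftrightarrow> d < card (F \<inter> {0..regs s 5})"
    and "regs s 3 \<le> regs s 5 - regs s 4"
proof -
  let ?a = "regs s 4" and ?b = "regs s 5"
  have mis: "{0..N} - F \<subseteq> {?a..?b}"
    using closure_inv_missing[OF inv] by auto
  have c: "card ({0..N} - F) = Suc (regs s 3)"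
    and ab: "?a \<le> ?b" "?b \<le> N" "regs s 0 = N"
    using inv fl by (auto simp: closure_inv_def missing_stored_def is_input_def)
  have "card (F \<inter> {?a..N}) + card ({0..N} - F) = card {?a..N}"
    using mis ab by (intro card_inter_missing) auto
  then show "d < regs s 0 - ?a - regs s 3 \<longleftrightarrow> d < card (F \<inter> {?a..N})" using c ab by auto
  have "card (F \<inter> {0..?b}) + card ({0..N} - F) = card {0..?b}"
    using mis ab by (intro card_inter_missing) auto
  then show "d < ?b - regs s 3 \<longleftrightarrow> d < card (F \<inter> {0..?b})" using c ab by auto
  have "card ({0..N} - F) \<le> card {?a..?b}" using mis by (intro card_mono) auto
  then show "regs s 3 \<le> ?b - ?a" using c ab by auto
qed

lemma closure_inv_flag_unset:
  assumes "closure_inv N d E F s" "regs s 2 \<noteq> 1" "E \<subseteq> {0..N}"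
  shows "F = {0..N}"
proof -
  have "missing_stored (card ({0..N} - F)) s" using assms(1) by (simp add: closure_inv_def)
  then have "card ({0..N} - F) = 0" unfolding missing_stored_def using assms(2) by presburger
  then have "{0..N} \<subseteq> F" by auto
  then show ?thesis using closure_inv_subset[OF assms(1,3)] by (rule subset_antisym[rotated])
qed

lemma bval_tests:
  assumes inv: "closure_inv N d E F s" and "d \<le> N" "N > 0"
  shows "bval N s left_test = Some (d < N - regs s 4 - regs s 3)"
    and "bval N s right_test = Some (d < regs s 5 - regs s 3)"
    and "bval N s loop_test = Some (regs s 2 = 1 \<and>
      (d < N - regs s 4 - regs s 3 \<or> d < regs s 5 - regs s 3))"
proof -
  \<comment> \<open>Definedness is needed also once the flag is cleared; then register 3 is 0 and
    the bound is trivial.\<close>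
  have le: "regs s 3 \<le> regs s 5 - regs s 4"
  proof (cases "regs s 2 = 1")
    case False
    then show ?thesis using inv by (auto simp: closure_inv_def missing_stored_def)
  qed (use closure_invD(3) inv in blast)
  have rest: "regs s 4 \<le> regs s 5" "regs s 5 \<le> N" "regs s 0 = N" "regs s 1 = d" "regs s 2 \<le> 1"
    using inv by (auto simp: closure_inv_def is_input_def missing_stored_def)
  show l: "bval N s left_test = Some (d < N - regs s 4 - regs s 3)"
    using le rest assms(2) by (auto simp: left_test_def in_range_def)
  show r: "bval N s right_test = Some (d < regs s 5 - regs s 3)"
    using le rest assms(2) by (auto simp: right_test_def in_range_def)
  show "bval N s loop_test = Some (regs s 2 = 1 \<and>
      (d < N - regs s 4 - regs s 3 \<or> d < regs s 5 - regs s 3))"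
    using rest assms(3)
    by (auto simp: loop_test_def in_range_def l r split: bool.split)
qed

text \<open>Either nothing is missing, or every missing \<open>t\<close> lies between the pointers.
  In the latter case \<open>{t..N}\<close> and \<open>{0..t}\<close> lie inside the two tested
  intervals, whose counts are at most \<open>d\<close>. So \<open>L\<close> adds nothing to
  \<open>F\<close>, and minimality of the closure applies.\<close>

lemma closure_inv_exit:
  assumes inv: "closure_inv N d E F s" and E: "E \<subseteq> {0..N}"
    and stop: "\<not> (regs s 2 = 1 \<and> (d < N - regs s 4 - regs s 3 \<or> d < regs s 5 - regs s 3))"
  shows "F = L_closure N d E"
proof
  show "F \<subseteq> L_closure N d E" using inv by (simp add: closure_inv_def)
  have F: "E \<subseteq> F" "F \<subseteq> {0..N}"
    using inv closure_inv_subset[OF inv E] by (simp_all add: closure_inv_def)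
  have fin: "finite F" using F(2) by (rule finite_subset) simp
  have "L N d F \<subseteq> F"
  proof (cases "regs s 2 = 1")
    case False
    then have "F = {0..N}" by (rule closure_inv_flag_unset[OF inv _ E])
    then show ?thesis using L_subset by simp
  next
    case True
    have N: "regs s 0 = N" using inv by (simp add: closure_inv_def is_input_def)
    have cl: "card (F \<inter> {regs s 4..N}) \<le> d" "card (F \<inter> {0..regs s 5}) \<le> d"
      using closure_invD(1,2)[OF inv True] stop True N by auto
    show ?thesis
    proof (rule subsetI, rule ccontr)
      fix t assume t: "t \<in> L N d F" "t \<notin> F"
      then have "t \<le> N" "d < card (F \<inter> {t..N}) \<or> d < card (F \<inter> {0..t})"
        using F(2) unfolding L_alt[OF F(2)] by auto
      moreover have "regs s 4 \<le> t" "t \<le> regs s 5"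
        using closure_inv_missing[OF inv] t(2) \<open>t \<le> N\<close> by blast+
      moreover have "card (F \<inter> {t..N}) \<le> card (F \<inter> {regs s 4..N})"
        "card (F \<inter> {0..t}) \<le> card (F \<inter> {0..regs s 5})"
        using \<open>regs s 4 \<le> t\<close> \<open>t \<le> regs s 5\<close> fin by (auto intro!: card_mono)
      ultimately show False using cl by linarith
    qed
  qed
  then show "L_closure N d E \<subseteq> F" by (rule L_closure_least[OF F])
qed

section \<open>One iteration of the main loop: progress and preservation of the invariant\<close>

lemma runs_fill:
  assumes inv: "closure_inv N d E F s" and "N > 0" "E \<subseteq> {0..N}" and fl: "regs s 2 = 1"
    and x: "regs s x \<le> N" "regs s x \<notin> F"
    and "d < card (F \<inter> {regs s x..N}) \<or> d < card (F \<inter> {0..regs s x})"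
  shows "runs N (fill x) s 11
    (\<lambda>s'. (\<exists>F'. closure_inv N d E F' s') \<and> potential s' < potential s)"
proof -
  define p F' where "p = regs s x" and "F' = insert p F"
  have F: "F \<subseteq> L_closure N d E" "F \<subseteq> {0..N}"
    using inv closure_inv_subset[OF inv assms(3)] by (simp_all add: closure_inv_def)
  \<comment> \<open>Either count exceeding \<open>d\<close> puts the point in
    \<open>L N d F\<close>, hence in the closure; so one argument serves both pointers.\<close>
  have "p \<in> L N d F" using assms(7) x unfolding L_alt[OF F(2)] p_def by simp
  then have "F' \<subseteq> L_closure N d E"
    using L_subset_L_closure[OF assms(3) F(1)] F(1) unfolding F'_def by blast
  moreover have "Suc (card ({0..N} - F')) = card ({0..N} - F)"
  proof -
    have "{0..N} - F' = ({0..N} - F) - {p}" by (auto simp: F'_def)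
    moreover have "p \<in> {0..N} - F" using x by (auto simp: p_def)
    ultimately show ?thesis by (metis card_Suc_Diff1 finite_Diff finite_atLeastAtMost)
  qed
  moreover have "E \<subseteq> F'" "{0..<regs s 4} \<subseteq> F'" "{regs s 5<..N} \<subseteq> F'"
    using inv unfolding closure_inv_def F'_def by (simp_all add: subset_insertI2)
  moreover have "card ({0..N} - F) = Suc (regs s 3)" "regs s 4 \<le> regs s 5" "regs s 5 \<le> N"
    "is_input N d F s"
    using inv fl by (simp_all add: closure_inv_def missing_stored_def)
  \<comment> \<open>One fewer point is missing, so the new number is the old register 3. Both
    branches of \<open>fill\<close>, clearing the flag and decrementing register 3, need only store
    this value.\<close>
  ultimately have new: "closure_inv N d E F' s'"
    if "arrs s' = (arrs s)(0 := (arrs s 0)(p := 1))" "regs s' 0 = regs s 0"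
      "regs s' 1 = regs s 1" "regs s' 4 = regs s 4" "regs s' 5 = regs s 5"
      "missing_stored (regs s 3) s'" for s'
    using that by (simp add: closure_inv_def is_input_def F'_def indicator_def)
  have le: "regs s 3 \<le> N"
    using closure_invD(3)[OF inv fl] \<open>regs s 5 \<le> N\<close> by simp
  have "runs N (fill x) s (3 + (bcost (Equal (Reg 3) (Lit 0)) + 4 + 1))
    (\<lambda>s'. (\<exists>F'. closure_inv N d E F' s') \<and> potential s' < potential s)"
    unfolding fill_def
    apply (rule runs_Seq)
    apply (rule runs_Write[where k = p and v = 1])
       apply (use x in \<open>simp add: p_def in_range_def\<close>)
      apply (use assms(2) in \<open>simp add: in_range_def\<close>)
     apply (rule runs_Cond[where v = "regs s 3 = 0"])
       apply (use le in \<open>simp add: in_range_def\<close>)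
      apply (rule runs_Assign[where v = 0])
        apply (simp add: in_range_def)
       apply (intro conjI exI[of _ F'] new)
            apply (use fl in \<open>auto simp: missing_stored_def potential_def\<close>)[7]
      apply simp
     apply (rule runs_Assign[where v = "regs s 3 - 1"])
       apply (use le assms(2) in \<open>simp add: in_range_def\<close>)
      apply (intro conjI exI[of _ F'] new)
           apply (use fl in \<open>auto simp: missing_stored_def potential_def\<close>)[7]
     apply simp
    apply simp
    done
  then show ?thesis by (rule runs_mono) auto
qed

lemma runs_loop_body:
  assumes inv: "closure_inv N d E F s" and N: "N > 0" and d: "d \<le> N" and E: "E \<subseteq> {0..N}"
    and go: "regs s 2 = 1" "d < N - regs s 4 - regs s 3 \<or> d < regs s 5 - regs s 3"
  shows "runs N loop_body s 30
    (\<lambda>s'. (\<exists>F'. closure_inv N d E F' s') \<and> potential s' < potential s)"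
proof -
  let ?Q = "\<lambda>s'. (\<exists>F'. closure_inv N d E F' s') \<and> potential s' < potential s"
  let ?a = "regs s 4" and ?b = "regs s 5"
  have ab: "?a \<le> ?b" "?b \<le> N" and N0: "regs s 0 = N"
    and arr: "\<And>i. i \<le> N \<Longrightarrow> arrs s 0 i = (if i \<in> F then 1 else 0)"
    using inv by (simp_all add: closure_inv_def is_input_def indicator_def)
  \<comment> \<open>The set flag supplies a missing point \<open>q\<close> between the pointers. If
    a pointer stands on a member of \<open>F\<close>, then \<open>q\<close> differs from it, so the
    pointers are distinct and stay ordered after the move.\<close>
  have "missing_stored (card ({0..N} - F)) s" using inv by (simp add: closure_inv_def)
  then have "{0..N} - F \<noteq> {}" using go(1) by (auto simp only: missing_stored_def card.empty)
  then obtain q where "q \<in> {0..N}" "q \<notin> F" by blast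
  then have q: "q \<notin> F" "?a \<le> q" "q \<le> ?b"
    using closure_inv_missing[OF inv] by auto
  have left: "runs N (Assign 4 (Add (Reg 4) (Lit 1))) s 4 ?Q" if "?a \<in> F"
  proof -
    have "q \<noteq> ?a" using q(1) that by blast
    then have lt: "?a < ?b" using q by simp
    have "{0..<?a} \<subseteq> F" using inv by (simp add: closure_inv_def)
    then have "{0..<Suc ?a} \<subseteq> F" using that by (simp add: atLeast0_lessThan_Suc)
    then have "closure_inv N d E F (s\<lparr>regs := (regs s)(4 := Suc ?a)\<rparr>)"
      using inv lt by (simp add: closure_inv_def is_input_def missing_stored_def)
    then show ?thesis using lt ab N
      by (intro runs_Assign[where v = "Suc ?a"]) (auto simp: in_range_def potential_def)
  qed
  have right: "runs N (Assign 5 (Sub (Reg 5) (Lit 1))) s 4 ?Q" if "?b \<in> F"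
  proof -
    have "q \<noteq> ?b" using q(1) that by blast
    then have lt: "?a < ?b" using q by simp
    have le: "?a \<le> ?b - 1" "?b - 1 \<le> N" using lt ab by simp_all
    have "{?b<..N} \<subseteq> F" using inv by (simp add: closure_inv_def)
    moreover have "{?b - 1<..N} \<subseteq> insert ?b {?b<..N}" by auto
    ultimately have "{?b - 1<..N} \<subseteq> F" using that by blast
    then have "closure_inv N d E F (s\<lparr>regs := (regs s)(5 := ?b - 1)\<rparr>)"
      using inv le by (simp add: closure_inv_def is_input_def missing_stored_def)
    then show ?thesis using lt ab N
      by (intro runs_Assign[where v = "?b - 1"]) (auto simp: in_range_def potential_def)
  qed
  have "runs N loop_body s (bcost left_test + (bcost (Equal (Read 0 (Reg 4)) (Lit 1)) + 11 + 1) + 1) ?Q"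
    unfolding loop_body_def
  proof (rule runs_Cond)
    show "bval N s left_test = Some (d < N - ?a - regs s 3)" using bval_tests(1)[OF inv d N] .
  next
    assume "d < N - ?a - regs s 3"
    then have "d < card (F \<inter> {?a..N})" using closure_invD(1)[OF inv go(1)] N0 by simp
    then show "runs N (Cond (Equal (Read 0 (Reg 4)) (Lit 1)) (Assign 4 (Add (Reg 4) (Lit 1))) (fill 4)) s
      (bcost (Equal (Read 0 (Reg 4)) (Lit 1)) + 11 + 1) ?Q"
      using runs_mono[OF left, of 11] runs_fill[OF inv N E go(1), of 4] ab N arr[of ?a]
      by (intro runs_Cond[where v = "?a \<in> F"]) (simp_all add: in_range_def)
  next
    assume "\<not> d < N - ?a - regs s 3"
    then have "d < card (F \<inter> {0..?b})" using closure_invD(2)[OF inv go(1)] go(2) by simp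
    then have "runs N (Cond (Equal (Read 0 (Reg 5)) (Lit 1)) (Assign 5 (Sub (Reg 5) (Lit 1))) (fill 5)) s
      (bcost (Equal (Read 0 (Reg 5)) (Lit 1)) + 11 + 1) ?Q"
      using runs_mono[OF right, of 11] runs_fill[OF inv N E go(1), of 5] ab N arr[of ?b]
      by (intro runs_Cond[where v = "?b \<in> F"]) (simp_all add: in_range_def)
    then show "runs N (Cond (Equal (Read 0 (Reg 5)) (Lit 1)) (Assign 5 (Sub (Reg 5) (Lit 1))) (fill 5)) s
      (bcost (Equal (Read 0 (Reg 4)) (Lit 1)) + 11 + 1) ?Q" by simp
  qed
  then show ?thesis by (rule runs_mono) (auto simp: left_test_def)
qed

section \<open>Total running time and correctness of the program\<close>

lemma runs_main_loop:
  assumes "closure_inv N d E E s" and N: "N > 0" and d: "d \<le> N" and E: "E \<subseteq> {0..N}"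
  shows "runs N (While loop_test loop_body) s (48 * Suc (potential s))
    (is_output N (L_closure N d E))"
proof -
  \<comment> \<open>The test costs 17, so the factor is 17 + 30 + 1 = 48. The invariant quantifies
    over \<open>F\<close> because the set grows from one iteration to the next.\<close>
  have "runs N (While loop_test loop_body) s ((bcost loop_test + 30 + 1) * Suc (potential s))
    (is_output N (L_closure N d E))"
  proof (rule runs_While[where I = "\<lambda>s. \<exists>F. closure_inv N d E F s"])
    show "\<exists>F. closure_inv N d E F s" using assms(1) by blast
  next
    fix s assume "\<exists>F. closure_inv N d E F s"
    then show "bval N s loop_test \<noteq> None" using bval_tests(3) d N by auto
  next
    fix s assume "\<exists>F. closure_inv N d E F s" and b: "bval N s loop_test = Some True"
    then obtain F where inv: "closure_inv N d E F s" by blast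
    show "runs N loop_body s 30 (\<lambda>s'. (\<exists>F. closure_inv N d E F s') \<and> potential s' < potential s)"
      using b bval_tests(3)[OF inv d N] by (intro runs_loop_body[OF inv N d E]) auto
  next
    fix s assume "\<exists>F. closure_inv N d E F s" and b: "bval N s loop_test = Some False"
    then obtain F where inv: "closure_inv N d E F s" by blast
    have "F = L_closure N d E"
      using b bval_tests(3)[OF inv d N] by (intro closure_inv_exit[OF inv E]) auto
    then show "is_output N (L_closure N d E) s"
      using inv by (simp add: closure_inv_def is_input_def is_output_def)
  qed
  then show ?thesis
    by (rule runs_mono) (auto simp: loop_test_def left_test_def right_test_def)
qed

lemma runs_closure_program:
  assumes N: "N > 0" and d: "d \<le> N" and E: "E \<subseteq> {0..N}" and inp: "is_input N d E s"
  shows "runs N closure_program s (150 * Suc N) (is_output N (L_closure N d E))"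
proof -
  have "runs N closure_program s (9 + 20 * Suc N + (2 + (2 + 48 * (2 * Suc N))))
    (is_output N (L_closure N d E))"
    unfolding closure_program_def
  proof (rule runs_Seq, rule runs_mono[OF runs_count_missing[OF N inp] order_refl])
    fix s assume s: "is_input N d E s \<and> missing_stored (card ({0..N} - E)) s"
    define s2 where "s2 = s\<lparr>regs := (regs s)(4 := 0, 5 := N)\<rparr>"
    have inv: "closure_inv N d E E s2"
      using s subset_L_closure
      by (auto simp: closure_inv_def s2_def is_input_def missing_stored_def)
    have "card ({0..N} - E) \<le> card {0..N}" by (intro card_mono) auto
    \<comment> \<open>The pointers start at distance \<open>N\<close> and at most
      \<open>N + 1\<close> points are missing.\<close>
    then have "potential s2 < 2 * Suc N"
      using s by (auto simp: potential_def s2_def missing_stored_def)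
    then have "runs N (While loop_test loop_body) s2 (48 * (2 * Suc N))
        (is_output N (L_closure N d E))"
      by (intro runs_mono[OF runs_main_loop[OF inv N d E]]) auto
    then show "runs N (Seq (Assign 4 (Lit 0)) (Seq (Assign 5 (Reg 0)) (While loop_test loop_body)))
        s (2 + (2 + 48 * (2 * Suc N))) (is_output N (L_closure N d E))"
      using s
      by (intro runs_Seq runs_Assign[where v = 0] runs_Assign[where v = N])
        (auto simp: in_range_def is_input_def s2_def)
  qed
  then show ?thesis by (rule runs_mono) auto
qed

theorem mainTheorem10:
  "\<exists>(P :: com) (T :: nat \<Rightarrow> nat).
     (\<lambda>N. real (T N)) \<in> O(\<lambda>N. real N) \<and>
     (\<forall>(N :: nat) (d :: nat) (E :: nat set) (s :: state).
        N > 0 \<longrightarrow> d \<in> {0..N} \<longrightarrow> E \<subseteq> {0..N} \<longrightarrow> is_input N d E s \<longrightarrow>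
        (\<exists>(t :: nat) (s' :: state).
           exec N P s t s' \<and> t \<le> T N \<and> is_output N (L_closure N d E) s'))"
proof (intro exI[of _ closure_program] exI[of _ "\<lambda>N. 150 * Suc N"] conjI allI impI)
  \<comment> \<open>For \<open>N\<close> at least 1, \<open>Suc N\<close> is at most
    \<open>2 * N\<close>, which gives the constant 300.\<close>
  show "(\<lambda>N. real (150 * Suc N)) \<in> O(\<lambda>N. real N)"
    by (intro bigoI[where c = 300] eventually_mono[OF eventually_ge_at_top[of 1]]) auto
next
  fix N d :: nat and E :: "nat set" and s :: state
  assume "N > 0" "d \<in> {0..N}" "E \<subseteq> {0..N}" "is_input N d E s"
  then show "\<exists>t s'. exec N closure_program s t s' \<and> t \<le> 150 * Suc N \<and>
      is_output N (L_closure N d E) s'"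
    using runs_closure_program unfolding runs_def by simp
qed

end
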